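(* If a simplicial polyhedron $P$ in $\mathbb{R}^n$ is decomposed into simplicial polyhedra $Q$ and $R$ (with $V(P),V(Q),V(R)$ nonzero), then $$ CCM(P)=\frac{V(Q)\,CCM(Q)+V(R)\,CCM(R)}{V(Q)+V(R)} . $$
   Context: An oriented simplicial polyhedron $P$ in $\mathbb{R}^n$ is one whose facets are nondegenerate $(n-1)$-dimensional simplices; each facet is written $F=(V_1,\dots,V_n)$ with its vertices ordered compatibly with the orientation of $\partial P$, so that $\partial P=\sum F$ is an $(n-1)$-dimensional simplicial cycle. For a point $O$ not in any hyperplane spanned by a facet, let $V_F=\frac{1}{n!}\det(V_1-O,\dots,V_n-O)$ be the signed volume and $C_F$ the circumcenter of the simplex with vertex $O$ and base $F$. The signed volume of $P$ is $V(P)=\sum_F V_F$, and if $V(P)\ne0$ the Circumcenter of Mass is $CCM(P)=\sum_F\frac{V_F}{V(P)}C_F$; neither depends on $O$. "$P$ is decomposed into $Q$ and $R$" means that $P$ is cut into $Q$ and $R$ along a simplicial cut: the oriented facets of $Q$ and $R$ together consist of the oriented facets of $P$ and of the simplices of the cut, each simplex of the cut being a facet of both $Q$ and $R$ with opposite orientations; i.e. $\partial P=\partial Q+\partial R$ as simplicial chains. *)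

theory Defs
  imports "HOL-Analysis.Analysis" "HOL-Library.Multiset"
begin

text \<open>
  An oriented \<open>(n-1)\<close>-simplex in \<open>\<real>\<^sup>n\<close> is given by its vertices \<open>V i\<close>, listed along the index type
  of the coordinates, so that the determinant of the matrix with rows \<open>V i - b\<close> makes sense
  without choosing an order on that type.  Reordering the vertices by a permutation \<open>s\<close> replaces
  \<open>V\<close> by \<open>V \<circ> s\<close>, which is the same oriented simplex if \<open>s\<close> is even and the opposite one if
  \<open>s\<close> is odd.
\<close>

type_synonym 'n facet = "'n \<Rightarrow> real ^ 'n"

definition nondegenerate_facet :: "'n::finite facet \<Rightarrow> bool" where
  "nondegenerate_facet F \<longleftrightarrow> inj F \<and> \<not> affine_dependent (range F)"

text \<open>
  A finite multiset \<open>P\<close> of ordered simplices represents the simplicial chain that is the sum of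
  its members.  \<open>chain_coeff P V\<close> is the coefficient of the oriented simplex \<open>V\<close> in this chain;
  modulo the identification of \<open>V \<circ> s\<close> with \<open>sign s \<cdot> V\<close>, two chains of nondegenerate simplices
  are equal iff all these coefficients agree.
\<close>

definition chain_coeff :: "'n::finite facet multiset \<Rightarrow> 'n facet \<Rightarrow> int" where
  "chain_coeff P V = (\<Sum>F\<in>#P. \<Sum>s | s permutes UNIV \<and> F \<circ> s = V. sign s)"

text \<open>
  \<open>boundary_coeff P i W\<close> is, up to a sign depending only on \<open>i\<close>, the coefficient in the boundary
  of the chain \<open>P\<close> of the oriented \<open>(n-2)\<close>-simplex with vertices \<open>W j\<close>, \<open>j \<noteq> i\<close>; the value of
  \<open>W\<close> at \<open>i\<close> is ignored.  For the index set \<open>{1,\<dots>,n}\<close> and \<open>i = 1\<close>, a permutation \<open>s\<close> in the inner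
  sum with \<open>s 1 = k\<close> says that omitting the \<open>k\<close>-th vertex of \<open>F\<close> leaves the vertices of \<open>W\<close>, and
  \<open>sign s\<close> is \<open>(-1)\<^sup>k\<^sup>-\<^sup>1\<close> times the sign of the reordering of the remaining ones, in accordance with
  \<open>\<partial>(V\<^sub>1,\<dots>,V\<^sub>n) = \<Sum>\<^sub>k (-1)\<^sup>k\<^sup>-\<^sup>1 (V\<^sub>1,\<dots>,V\<^sub>k\<^sub>-\<^sub>1,V\<^sub>k\<^sub>+\<^sub>1,\<dots>,V\<^sub>n)\<close>.  If \<open>n = 1\<close> this is the augmented boundary;
  an ordering cannot express a negatively oriented point, so \<open>{#}\<close> is then the only cycle.
\<close>

definition boundary_coeff :: "'n::finite facet multiset \<Rightarrow> 'n \<Rightarrow> 'n facet \<Rightarrow> int" where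
  "boundary_coeff P i W =
     (\<Sum>F\<in>#P. \<Sum>s | s permutes UNIV \<and> (\<forall>j. j \<noteq> i \<longrightarrow> F (s j) = W j). sign s)"

definition simplicial_cycle :: "'n::finite facet multiset \<Rightarrow> bool" where
  "simplicial_cycle P \<longleftrightarrow> (\<forall>i W. boundary_coeff P i W = 0)"

text \<open>An oriented simplicial polyhedron is represented by the multiset of its oriented facets.\<close>

definition simplicial_polyhedron :: "'n::finite facet multiset \<Rightarrow> bool" where
  "simplicial_polyhedron P \<longleftrightarrow> (\<forall>F\<in>#P. nondegenerate_facet F) \<and> simplicial_cycle P"

definition decomposed_into ::
  "'n::finite facet multiset \<Rightarrow> 'n facet multiset \<Rightarrow> 'n facet multiset \<Rightarrow> bool" where
  "decomposed_into P Q R \<longleftrightarrow> (\<forall>V. chain_coeff P V = chain_coeff Q V + chain_coeff R V)"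

lemma chain_coeff_reorder:
  fixes K :: "'n::finite facet multiset"
  assumes t: "\<And>F. t F permutes UNIV"
  shows "chain_coeff (image_mset (\<lambda>F. F \<circ> t F) K) V =
    (\<Sum>F\<in>#K. sign (t F) * (\<Sum>s | s permutes UNIV \<and> F \<circ> s = V. sign s))"
proof -
  have "(\<Sum>s | s permutes UNIV \<and> (F \<circ> t F) \<circ> s = V. sign s)
      = sign (t F) * (\<Sum>s | s permutes UNIV \<and> F \<circ> s = V. sign s)" for F
  proof -
    have "(\<Sum>s | s permutes UNIV \<and> F \<circ> s = V. sign (t F) * sign s)
        = (\<Sum>s | s permutes UNIV \<and> (F \<circ> t F) \<circ> s = V. sign s)"
    proof (rule sum.reindex_bij_witness[where i = "\<lambda>s. t F \<circ> s" and j = "\<lambda>s. inv (t F) \<circ> s"])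
      fix s assume s: "s \<in> {s. s permutes UNIV \<and> F \<circ> s = V}"
      show "t F \<circ> (inv (t F) \<circ> s) = s"
        using permutes_inv_o(1)[OF t[of F]] by (simp add: o_assoc)
      show "inv (t F) \<circ> s \<in> {s. s permutes UNIV \<and> (F \<circ> t F) \<circ> s = V}"
        using s permutes_inv[OF t[of F]] permutes_inv_o(1)[OF t[of F]]
        by (auto intro!: permutes_compose simp: comp_assoc) (metis comp_assoc comp_id fun.map_comp)
      show "sign (inv (t F) \<circ> s) = sign (t F) * sign s"
      proof -
        have p: "permutation s" "permutation (t F)"
          using s t[of F] by (auto intro: permutes_imp_permutation[OF finite])
        then show ?thesis
          by (simp add: sign_compose sign_inverse permutation_inverse)
      qed
    next
      fix s assume s: "s \<in> {s. s permutes UNIV \<and> (F \<circ> t F) \<circ> s = V}"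
      show "inv (t F) \<circ> (t F \<circ> s) = s"
        using permutes_inv_o(2)[OF t[of F]] by (simp add: o_assoc)
      show "t F \<circ> s \<in> {s. s permutes UNIV \<and> F \<circ> s = V}"
        using s t[of F] by (auto intro!: permutes_compose simp: comp_assoc)
    qed
    then show ?thesis by (simp add: sum_distrib_left)
  qed
  then show ?thesis by (simp add: chain_coeff_def multiset.map_comp comp_def)
qed

text \<open>
  The geometric situation: the facets of \<open>P\<close> are distributed into \<open>A\<close> and \<open>B\<close>, and every simplex
  of the cut \<open>K\<close> is added to \<open>A\<close> and, with the opposite orientation, to \<open>B\<close>.
\<close>

lemma decomposed_into_cut:
  fixes A B K :: "'n::finite facet multiset"
  assumes "\<And>F. t F permutes UNIV" and "\<And>F. sign (t F) = -1"
  shows "decomposed_into (A + B) (A + K) (B + image_mset (\<lambda>F. F \<circ> t F) K)"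
proof -
  have "chain_coeff (image_mset (\<lambda>F. F \<circ> t F) K) V = - chain_coeff K V" for V
    using sum_mset_distrib_left[of "-1" "\<lambda>F. \<Sum>s | s permutes UNIV \<and> F \<circ> s = V. sign s" K]
    by (subst chain_coeff_reorder[OF assms(1)]) (simp add: assms(2) chain_coeff_def)
  moreover have "chain_coeff (M + N) V = chain_coeff M V + chain_coeff N V"
    for M N :: "'n facet multiset" and V
    by (simp add: chain_coeff_def)
  ultimately show ?thesis
    by (simp add: decomposed_into_def)
qed

definition facet_volume :: "real ^ 'n::finite \<Rightarrow> 'n facet \<Rightarrow> real" where
  "facet_volume b F = det (\<chi> i. F i - b) / fact CARD('n)"

definition circumcenter :: "'a::euclidean_space set \<Rightarrow> 'a" where
  "circumcenter S = (THE c. c \<in> affine hull S \<and> (\<exists>r. \<forall>v\<in>S. dist c v = r))"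

definition admissible_base :: "'n::finite facet multiset \<Rightarrow> real ^ 'n \<Rightarrow> bool" where
  "admissible_base P b \<longleftrightarrow> (\<forall>F\<in>#P. b \<notin> affine hull (range F))"

text \<open>
  Both quantities below are defined as the common value for all admissible base points.
\<close>

definition signed_volume :: "'n::finite facet multiset \<Rightarrow> real" where
  "signed_volume P =
     (THE v. \<forall>b. admissible_base P b \<longrightarrow> v = (\<Sum>F\<in>#P. facet_volume b F))"

definition ccm :: "'n::finite facet multiset \<Rightarrow> real ^ 'n" where
  "ccm P = (THE c. \<forall>b. admissible_base P b \<longrightarrow>
     c = (\<Sum>F\<in>#P. (facet_volume b F / signed_volume P) *\<^sub>R circumcenter (insert b (range F))))"

end

theory Submission
  imports Defs
begin

text \<open>
  Both the volume of the simplex with vertex \<open>b\<close> and base \<open>F\<close> and, by Cramer's rule, the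
  coordinates of its circumcenter multiplied by this volume are of the form
  \<open>det (\<phi> (F i) - \<phi> b)\<close> up to a constant factor, for a suitable map \<open>\<phi>\<close>.  This expression
  is alternating in the vertices of \<open>F\<close>, so its sum over the facets depends only on the chain
  and is additive.  The terms of its expansion in which \<open>\<phi> b\<close> occurs are functions of the
  boundary faces of \<open>F\<close>, so on a cycle they cancel and the sum does not depend on \<open>b\<close>.
\<close>

definition lift_det :: "(real ^ 'n \<Rightarrow> real ^ 'n) \<Rightarrow> real ^ 'n \<Rightarrow> 'n::finite facet \<Rightarrow> real" where
  "lift_det \<phi> b F = det (\<chi> i. \<phi> (F i) - \<phi> b)"

section \<open>Additivity over chains\<close>

text \<open>Double counting: the pairs \<open>(F, s)\<close> are grouped by the value
  \<open>g F s\<close>. With value \<open>F \<circ> s\<close> this serves chain coefficients; with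
  one vertex of \<open>F \<circ> s\<close> blanked it serves boundary coefficients.\<close>

lemma signed_fibre_sum:
  fixes g :: "'n::finite facet \<Rightarrow> ('n \<Rightarrow> 'n) \<Rightarrow> 'n facet" and \<psi> :: "'n facet \<Rightarrow> real"
  assumes "finite X" and "\<And>F s. F \<in># P \<Longrightarrow> s permutes UNIV \<Longrightarrow> g F s \<in> X"
  shows "(\<Sum>V\<in>X. of_int (\<Sum>F\<in>#P. \<Sum>s | s permutes UNIV \<and> g F s = V. sign s) * \<psi> V)
    = (\<Sum>F\<in>#P. \<Sum>s | s permutes UNIV. of_int (sign s) * \<psi> (g F s))"
  using assms(2)
proof (induction P)
  case (add F P)
  have "(\<Sum>V\<in>X. of_int (\<Sum>s | s permutes UNIV \<and> g F s = V. sign s) * \<psi> V)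
    = (\<Sum>V\<in>X. \<Sum>s\<in>{s\<in>{s. s permutes UNIV}. g F s = V}. of_int (sign s) * \<psi> (g F s))"
    by (simp add: sum_distrib_right)
  also have "\<dots> = (\<Sum>s | s permutes UNIV. of_int (sign s) * \<psi> (g F s))"
    using assms(1) add.prems by (intro sum.group) auto
  finally show ?case
    using add by (simp add: distrib_right sum.distrib)
qed simp

lemma lift_det_permute:
  assumes "s permutes UNIV"
  shows "lift_det \<phi> b (F \<circ> s) = of_int (sign s) * lift_det \<phi> b F"
  using det_permute_rows[OF assms, of "\<chi> i. \<phi> (F i) - \<phi> b"] by (simp add: lift_det_def)

text \<open>Summing the alternating function \<open>lift_det \<phi> b\<close> against chain
  coefficients counts every facet once per reordering, so additivity of the coefficients passes to
  the facet sums.\<close>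

lemma sum_lift_det_additive:
  fixes P Q R :: "'n::finite facet multiset"
  assumes "decomposed_into P Q R"
  shows "(\<Sum>F\<in>#P. lift_det \<phi> b F) = (\<Sum>F\<in>#Q. lift_det \<phi> b F) + (\<Sum>F\<in>#R. lift_det \<phi> b F)"
proof -
  \<comment> \<open>One finite set holding all reorderings of facets of the three chains, so that
    the three sums over it can be compared term by term.\<close>
  define X where "X = (\<Union>F\<in>set_mset (P + Q + R). (\<lambda>s. F \<circ> s) ` {s. s permutes UNIV})"
  have X: "finite X"
    by (simp add: X_def)
  have *: "(\<Sum>V\<in>X. of_int (chain_coeff S V) * lift_det \<phi> b V)
      = fact CARD('n) * (\<Sum>F\<in>#S. lift_det \<phi> b F)"
    if S: "S \<in> {P, Q, R}" for S :: "'n facet multiset"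
  proof -
    have in_X: "F \<circ> s \<in> X" if "F \<in># S" "s permutes UNIV" for F s
      using that S by (auto simp: X_def)
    have "(\<Sum>s | s permutes UNIV. of_int (sign s) * lift_det \<phi> b (F \<circ> s))
        = fact CARD('n) * lift_det \<phi> b F" for F :: "'n facet"
    proof -
      \<comment> \<open>The weight \<open>sign s\<close> and the sign produced by
        \<open>lift_det_permute\<close> multiply to 1.\<close>
      have "(\<Sum>s | s permutes UNIV. of_int (sign s) * lift_det \<phi> b (F \<circ> s))
          = (\<Sum>s | s permutes (UNIV :: 'n set). lift_det \<phi> b F)"
        by (intro sum.cong) (auto simp: lift_det_permute sign_def)
      then show ?thesis
        by (simp add: card_permutations[OF refl])
    qed
    then show ?thesis
      using signed_fibre_sum[OF X in_X, where \<psi> = "lift_det \<phi> b"]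
      by (simp add: chain_coeff_def sum_mset_distrib_left)
  qed
  have "fact CARD('n) * (\<Sum>F\<in>#P. lift_det \<phi> b F) = fact CARD('n) *
      ((\<Sum>F\<in>#Q. lift_det \<phi> b F) + (\<Sum>F\<in>#R. lift_det \<phi> b F) :: real)"
    using assms *[of P] *[of Q] *[of R]
    by (simp add: decomposed_into_def distrib_left distrib_right sum.distrib)
  then show ?thesis
    by simp
qed

section \<open>Independence of the base point\<close>

text \<open>Row \<open>x\<close> is \<open>\<beta>\<close> itself, so each subtraction is a row
  operation.\<close>

lemma det_subtract_rows_fixed:
  fixes a :: "'n::finite \<Rightarrow> real ^ 'n"
  assumes "finite S" "x \<notin> S"
  shows "det (\<chi> i. if i = x then \<beta> else if i \<in> S then a i - \<beta> else a i)
    = det (\<chi> i. if i = x then \<beta> else a i)"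
  using assms
proof (induction S)
  case (insert y S)
  define A :: "real ^ 'n ^ 'n" where
    "A = (\<chi> i. if i = x then \<beta> else if i \<in> S then a i - \<beta> else a i)"
  have "(\<chi> i. if i = x then \<beta> else if i \<in> insert y S then a i - \<beta> else a i)
      = (\<chi> k. if k = y then row y A + (- 1) *s row x A else row k A)"
    using insert by (auto simp: A_def row_def vec_eq_iff)
  then show ?case
    using insert det_row_operation[of y x A "- 1"] by (auto simp: A_def)
qed (simp cong: if_cong)

text \<open>Multilinearity in the rows: terms with \<open>\<beta>\<close> in two rows vanish. The
  induction runs over the set of rows from which \<open>\<beta>\<close> is subtracted.\<close>

lemma det_subtract_rows:
  fixes a :: "'n::finite \<Rightarrow> real ^ 'n"
  shows "det (\<chi> i. a i - \<beta>) = det (\<chi> i. a i) - (\<Sum>k\<in>UNIV. det (\<chi> i. if i = k then \<beta> else a i))"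
proof -
  have "det (\<chi> i. if i \<in> S then a i - \<beta> else a i)
      = det (\<chi> i. a i) - (\<Sum>k\<in>S. det (\<chi> i. if i = k then \<beta> else a i))" if "finite S" for S
    using that
  proof (induction S)
    case (insert x S)
    define c where "c i = (if i \<in> S then a i - \<beta> else a i)" for i
    have split: "det (\<chi> i. if i \<in> insert x S then a i - \<beta> else a i)
        = det (\<chi> i. if i = x then a i else c i) + det (\<chi> i. if i = x then - \<beta> else c i)"
      unfolding det_row_add[symmetric]
      by (intro arg_cong[where f = det]) (auto simp: c_def vec_eq_iff)
    have "det (\<chi> i. if i = x then a i else c i) = det (\<chi> i. if i \<in> S then a i - \<beta> else a i)"
      using insert by (intro arg_cong[where f = det]) (auto simp: c_def vec_eq_iff)
    moreover have "det (\<chi> i. if i = x then - \<beta> else c i)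
        = - det (\<chi> i. if i = x then \<beta> else c i)"
      using det_row_mul[of x "- 1" "\<lambda>_. \<beta>" c]
      by (simp cong: if_cong)
    moreover have "\<dots> = - det (\<chi> i. if i = x then \<beta> else a i)"
      using det_subtract_rows_fixed[OF insert(1,2), of \<beta> a] by (simp add: c_def cong: if_cong)
    ultimately show ?case
      using insert split by simp
  qed simp
  from this[of UNIV] show ?thesis
    by simp
qed

text \<open>With \<open>\<beta>\<close> in row \<open>k\<close>, the determinant depends on
  \<open>F\<close> only through the face opposite its \<open>k\<close>-th vertex and alternates in
  that face. The sum therefore pairs with the boundary coefficients, which are zero.\<close>

lemma cycle_cofactor_sum:
  fixes P :: "'n::finite facet multiset" and \<beta> :: "real ^ 'n"
  assumes "simplicial_cycle P"
  shows "(\<Sum>F\<in>#P. \<Sum>k\<in>UNIV. det (\<chi> i. if i = k then \<beta> else \<phi> (F i))) = 0"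
proof -
  define D where "D F k = det (\<chi> i. if i = k then \<beta> else \<phi> (F i))" for F :: "'n facet" and k
  \<comment> \<open>\<open>D V k\<close> ignores \<open>V k\<close>, so that vertex is set to the
    dummy value 0, giving each ordered face a single representative. Permuting rows by
    \<open>s\<close> moves the row \<open>\<beta>\<close> from \<open>k\<close> to
    \<open>s k\<close>.\<close>
  have D_permute: "of_int (sign s) * D ((F \<circ> s)(k := 0)) k = D F (s k)"
    if "s permutes UNIV" for F :: "'n facet" and s k
  proof -
    have "D ((F \<circ> s)(k := 0)) k = det (\<chi> i. (\<chi> j. if j = s k then \<beta> else \<phi> (F j)) $ s i)"
      unfolding D_def using permutes_inj[OF that]
      by (intro arg_cong[where f = det]) (auto simp: vec_eq_iff inj_def)
    then show ?thesis
      using det_permute_rows[OF that, of "\<chi> j. if j = s k then \<beta> else \<phi> (F j)"]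
      by (simp add: D_def sign_def)
  qed
  have zero: "(\<Sum>F\<in>#P. \<Sum>s | s permutes UNIV. D F (s i)) = 0" for i
  proof -
    define g where "g F s = (F \<circ> s)(i := 0)" for F :: "'n facet" and s
    define X where "X = (\<Union>F\<in>set_mset P. g F ` {s. s permutes UNIV})"
    have X: "finite X"
      by (simp add: X_def)
    have in_X: "g F s \<in> X" if "F \<in># P" "s permutes UNIV" for F s
      unfolding X_def using that by blast
    have "(\<Sum>F\<in>#P. \<Sum>s | s permutes UNIV \<and> g F s = V. sign s) = 0" if "V \<in> X" for V
    proof -
      have "V i = 0"
        using that by (auto simp: X_def g_def)
      then have "g F s = V \<longleftrightarrow> (\<forall>j. j \<noteq> i \<longrightarrow> F (s j) = V j)" for F s
        by (auto simp: g_def fun_eq_iff)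
      then show ?thesis
        using assms by (simp add: simplicial_cycle_def boundary_coeff_def)
    qed
    then have "(\<Sum>F\<in>#P. \<Sum>s | s permutes UNIV. of_int (sign s) * D (g F s) i) = 0"
      using signed_fibre_sum[where g = g and P = P and \<psi> = "\<lambda>V. D V i", OF X in_X] by simp
    then show ?thesis
      by (simp add: g_def D_permute)
  qed
  \<comment> \<open>For each of the \<open>n!\<close> permutations \<open>s\<close>, the map
    \<open>i \<mapsto> s i\<close> only reorders the sum over the omitted vertices.\<close>
  have "(\<Sum>i\<in>UNIV. \<Sum>s | s permutes UNIV. D F (s i)) = fact CARD('n) * (\<Sum>k\<in>UNIV. D F k)" for F
  proof -
    have "(\<Sum>i\<in>UNIV. \<Sum>s | s permutes UNIV. D F (s i))
        = (\<Sum>s | s permutes (UNIV :: 'n set). \<Sum>i\<in>UNIV. D F (s i))"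
      by (rule sum.swap)
    also have "\<dots> = (\<Sum>s | s permutes (UNIV :: 'n set). \<Sum>k\<in>UNIV. D F k)"
      by (rule sum.cong[OF refl]) (simp add: sum.permute[of _ UNIV "D F"] comp_def)
    finally show ?thesis
      by (simp add: card_permutations[OF refl])
  qed
  then have "fact CARD('n) * (\<Sum>F\<in>#P. \<Sum>k\<in>UNIV. D F k)
      = (\<Sum>F\<in>#P. \<Sum>i\<in>UNIV. \<Sum>s | s permutes UNIV. D F (s i))"
    by (simp add: sum_mset_distrib_left)
  also have "\<dots> = (\<Sum>i\<in>UNIV. \<Sum>F\<in>#P. \<Sum>s | s permutes UNIV. D F (s i))"
    by (induction P) (simp_all add: sum.distrib)
  finally show ?thesis
    using zero by (simp add: D_def)
qed

text \<open>The right-hand side is free of \<open>b\<close>: base point independence for every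
  \<open>\<phi>\<close> at once.\<close>

lemma cycle_sum_lift_det:
  fixes P :: "'n::finite facet multiset"
  assumes "simplicial_cycle P"
  shows "(\<Sum>F\<in>#P. lift_det \<phi> b F) = (\<Sum>F\<in>#P. det (\<chi> i. \<phi> (F i)))"
proof -
  have "(\<Sum>F\<in>#P. det (\<chi> i. \<phi> (F i)))
      = (\<Sum>F\<in>#P. lift_det \<phi> b F + (\<Sum>k\<in>UNIV. det (\<chi> i. if i = k then \<phi> b else \<phi> (F i))))"
    by (simp add: lift_det_def det_subtract_rows)
  also have "\<dots> = (\<Sum>F\<in>#P. lift_det \<phi> b F)"
    by (simp add: sum_mset.distrib cycle_cofactor_sum[OF assms])
  finally show ?thesis
    by simp
qed

section \<open>Base points and the signed volume\<close>

text \<open>The hull of \<open>n\<close> points has dimension below \<open>n\<close>, and finitely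
  many closed sets with empty interior cannot cover the space. Existence makes the values described
  by \<open>signed_volume\<close> and \<open>ccm\<close> unique.\<close>

lemma admissible_base_exists:
  fixes P :: "'n::finite facet multiset"
  shows "\<exists>b. admissible_base P b"
proof -
  have "interior (affine hull (range F)) = {}" for F :: "'n facet"
  proof (rule ccontr)
    assume "interior (affine hull (range F)) \<noteq> {}"
    then have "aff_dim (range F) = int CARD('n)"
      using aff_dim_nonempty_interior[of "affine hull (range F)"] by simp
    moreover have "aff_dim (range F) \<le> int (card (range F)) - 1"
      by (rule aff_dim_le_card) simp
    ultimately show False
      using card_image_le[of UNIV F] by simp
  qed
  then have "interior (\<Union>F\<in>set_mset P. affine hull (range F)) = {}"
  proof (induction P)
    case (add F P)
    then show ?case
      using interior_closed_Un_empty_interior[of "affine hull (range F)"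
          "\<Union>F\<in>set_mset P. affine hull (range F)"]
      by (simp add: closed_affine_hull)
  qed simp
  then have "(\<Union>F\<in>set_mset P. affine hull (range F)) \<noteq> UNIV"
    by auto
  then show ?thesis
    by (auto simp: admissible_base_def)
qed

text \<open>Here \<open>b\<close> is arbitrary, admissible or not, so one point can serve several
  polyhedra.\<close>

lemma signed_volume_eq:
  fixes P :: "'n::finite facet multiset"
  assumes "simplicial_cycle P"
  shows "signed_volume P = (\<Sum>F\<in>#P. lift_det (\<lambda>v. v) b F) / fact CARD('n)"
proof -
  have *: "(\<Sum>F\<in>#P. facet_volume c F) = (\<Sum>F\<in>#P. lift_det (\<lambda>v. v) b F) / fact CARD('n)" for c
  proof -
    have "(\<Sum>F\<in>#P. facet_volume c F) = (\<Sum>F\<in>#P. lift_det (\<lambda>v. v) c F) / fact CARD('n)"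
      by (induction P) (simp_all add: facet_volume_def lift_det_def add_divide_distrib)
    then show ?thesis
      by (simp add: cycle_sum_lift_det[OF assms])
  qed
  show ?thesis
    unfolding signed_volume_def * using admissible_base_exists[of P] by blast
qed

section \<open>Circumcenters by Cramer's rule\<close>

text \<open>Adding \<open>b\<close> keeps the vertices affinely independent, so the differences
  \<open>F i - b\<close> are linearly independent rows.\<close>

lemma det_facet_nonzero:
  fixes F :: "'n::finite facet"
  assumes "nondegenerate_facet F" and b: "b \<notin> affine hull (range F)"
  shows "det (\<chi> i. F i - b) \<noteq> 0"
proof -
  have "inj F" and "\<not> affine_dependent (insert b (range F))"
    using assms affine_independent_insert by (auto simp: nondegenerate_facet_def)
  moreover have "b \<notin> range F"
    using b hull_inc by metis
  ultimately have indep: "independent ((\<lambda>i. F i - b) ` UNIV)"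
    by (simp add: affine_dependent_iff_dependent image_image)
  have inj: "inj (\<lambda>i. F i - b)"
    using \<open>inj F\<close> by (auto simp: inj_def)
  have row: "row i (\<chi> i. F i - b) = F i - b" for i
    by (simp add: row_def vec_eq_iff)
  have "c i = 0" if "(\<Sum>i\<in>UNIV. c i *s row i (\<chi> i. F i - b)) = 0" for c i
  proof -
    \<comment> \<open>Coefficients indexed by \<open>i\<close> are carried along the injection to
      the vectors, since \<open>independent\<close> speaks of a set.\<close>
    let ?u = "\<lambda>v. c (inv (\<lambda>i. F i - b) v)"
    have "(\<Sum>v\<in>range (\<lambda>i. F i - b). ?u v *\<^sub>R v) = 0"
      using that row by (simp add: sum.reindex[OF inj] inv_f_f[OF inj] scalar_mult_eq_scaleR)
    then have "?u (F i - b) = 0"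
      using indep by (intro independentD[OF indep, where u = ?u]) auto
    then show ?thesis
      using inv_f_f[OF inj, of i] by simp
  qed
  then show ?thesis
    unfolding invertible_det_nz[symmetric] invertible_right_inverse
      matrix_right_invertible_independent_rows by blast
qed

text \<open>
  The equations \<open>|c - v| = |c - b|\<close> for the vertices \<open>v\<close> form a linear system in \<open>c\<close>, and the
  determinants in Cramer's rule for it arise from replacing the \<open>k\<close>-th coordinate of every
  point \<open>v\<close> by \<open>|v|\<^sup>2 / 2\<close>.
\<close>

definition paraboloid_lift :: "'n \<Rightarrow> real ^ 'n \<Rightarrow> real ^ 'n::finite" where
  "paraboloid_lift k v = (\<chi> j. if j = k then (v \<bullet> v) / 2 else v $ j)"

lemma circumcenter_eq:
  fixes F :: "'n::finite facet"
  assumes F: "nondegenerate_facet F" and b: "b \<notin> affine hull (range F)"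
  shows "circumcenter (insert b (range F))
    = (\<chi> k. lift_det (paraboloid_lift k) b F / lift_det (\<lambda>v. v) b F)"
proof -
  define A :: "real ^ 'n ^ 'n" where "A = (\<chi> i. F i - b)"
  define y :: "real ^ 'n" where "y = (\<chi> i. (F i \<bullet> F i - b \<bullet> b) / 2)"
  \<comment> \<open>These \<open>n + 1\<close> affinely independent points span the space, so the
    hull condition in \<open>circumcenter\<close> always holds.\<close>
  have "\<not> affine_dependent (insert b (range F))"
    using F b affine_independent_insert by (auto simp: nondegenerate_facet_def)
  moreover have "b \<notin> range F"
    using b hull_inc by metis
  then have "card (insert b (range F)) = Suc (DIM(real ^ 'n))"
    using F by (simp add: nondegenerate_facet_def card_image)
  ultimately have hull: "affine hull (insert b (range F)) = UNIV"
    by (rule affine_independent_span_eq)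
  \<comment> \<open>On squaring both distances \<open>c \<bullet> c\<close> cancels, which leaves an
    equation linear in \<open>c\<close>.\<close>
  have equidist: "dist c v = dist c b \<longleftrightarrow> (v - b) \<bullet> c = (v \<bullet> v - b \<bullet> b) / 2" for c v :: "real ^ 'n"
    by (auto simp: dist_norm norm_eq algebra_simps inner_commute)
  have "c \<in> affine hull (insert b (range F)) \<and> (\<exists>r. \<forall>v\<in>insert b (range F). dist c v = r)
      \<longleftrightarrow> c = (\<chi> k. lift_det (paraboloid_lift k) b F / lift_det (\<lambda>v. v) b F)" for c
  proof -
    have "(\<exists>r. \<forall>v\<in>insert b (range F). dist c v = r) \<longleftrightarrow> (\<forall>i. dist c (F i) = dist c b)"
      by auto
    also have "\<dots> \<longleftrightarrow> A *v c = y"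
      unfolding equidist by (simp add: A_def y_def vec_eq_iff matrix_vector_mul_component)
    also have "\<dots> \<longleftrightarrow> c = (\<chi> k. det (\<chi> i j. if j = k then y $ i else A $ i $ j) / det A)"
      using det_facet_nonzero[OF F b] by (intro cramer) (simp add: A_def)
    \<comment> \<open>The entry \<open>y $ i\<close> is the \<open>k\<close>-th coordinate of
      \<open>paraboloid_lift k (F i) - paraboloid_lift k b\<close>.\<close>
    also have "(\<chi> k. det (\<chi> i j. if j = k then y $ i else A $ i $ j) / det A)
        = (\<chi> k. lift_det (paraboloid_lift k) b F / lift_det (\<lambda>v. v) b F)"
      unfolding lift_det_def A_def y_def
      by (intro arg_cong[where f = vec_lambda] ext arg_cong2[where f = "(/)"] arg_cong[where f = det])
        (auto simp: vec_eq_iff paraboloid_lift_def diff_divide_distrib)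
    finally show ?thesis
      by (simp add: hull)
  qed
  then show ?thesis
    by (simp add: circumcenter_def)
qed

section \<open>Volume-weighted circumcenters and their additivity\<close>

text \<open>The facet volume cancels the denominator in Cramer's rule, leaving lifted determinants
  whose sum over a cycle is the same for every \<open>b\<close>.\<close>

lemma volume_scaled_ccm:
  fixes P :: "'n::finite facet multiset"
  assumes P: "simplicial_polyhedron P" and "signed_volume P \<noteq> 0"
  shows "signed_volume P *\<^sub>R ccm P
    = (\<chi> k. (\<Sum>F\<in>#P. lift_det (paraboloid_lift k) b F) / fact CARD('n))"
proof -
  define V where "V = signed_volume P"
  define m where "m = (\<chi> k. (\<Sum>F\<in>#P. lift_det (paraboloid_lift k) b F) / fact CARD('n))"
  \<comment> \<open>Circumcenters need an admissible \<open>c\<close>; \<open>m\<close> is computed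
    at the given \<open>b\<close>, and the two sums agree by
    \<open>cycle_sum_lift_det\<close>.\<close>
  have *: "(\<Sum>F\<in>#P. (facet_volume c F / V) *\<^sub>R circumcenter (insert c (range F)))
      = (1 / V) *\<^sub>R m" if c: "admissible_base P c" for c
  proof -
    have facet: "(facet_volume c F / V) *\<^sub>R circumcenter (insert c (range F))
        = (1 / V) *\<^sub>R (\<chi> k. lift_det (paraboloid_lift k) c F / fact CARD('n))"
      if "F \<in># P" for F
    proof -
      have F: "nondegenerate_facet F" "c \<notin> affine hull (range F)"
        using P c that by (auto simp: simplicial_polyhedron_def admissible_base_def)
      show ?thesis
        using det_facet_nonzero[OF F]
        by (simp add: circumcenter_eq[OF F] facet_volume_def lift_det_def vec_eq_iff)
    qed
    have "(\<Sum>F\<in>#P. (\<chi> k. lift_det (paraboloid_lift k) c F / fact CARD('n)))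
        = (\<chi> k. (\<Sum>F\<in>#P. lift_det (paraboloid_lift k) c F) / fact CARD('n))"
      by (induction P) (simp_all add: vec_eq_iff add_divide_distrib)
    also have "\<dots> = m"
      using P by (simp add: m_def simplicial_polyhedron_def cycle_sum_lift_det)
    finally have sum: "(\<Sum>F\<in>#P. (\<chi> k. lift_det (paraboloid_lift k) c F / fact CARD('n))) = m" .
    have "(\<Sum>F\<in>#P. (facet_volume c F / V) *\<^sub>R circumcenter (insert c (range F)))
        = (\<Sum>F\<in>#P. (1 / V) *\<^sub>R
            (\<chi> k. lift_det (paraboloid_lift k) c F / fact CARD('n)))"
      by (intro arg_cong[where f = sum_mset] image_mset_cong facet)
    also have "\<dots> = (1 / V) *\<^sub>R
        (\<Sum>F\<in>#P. (\<chi> k. lift_det (paraboloid_lift k) c F / fact CARD('n)))"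
      by (induction P) (simp_all add: scaleR_add_right)
    finally show ?thesis
      by (simp add: sum)
  qed
  have "ccm P = (1 / signed_volume P) *\<^sub>R m"
    unfolding ccm_def V_def[symmetric] using admissible_base_exists[of P] * by (intro the_equality) auto
  then show ?thesis
    using assms(2) by (simp add: m_def)
qed

theorem theorem7:
  fixes P Q R :: "'n::finite facet multiset"
  assumes "simplicial_polyhedron P" and "simplicial_polyhedron Q" and "simplicial_polyhedron R"
    and "decomposed_into P Q R"
    and "signed_volume P \<noteq> 0" and "signed_volume Q \<noteq> 0" and "signed_volume R \<noteq> 0"
  shows "ccm P = (1 / (signed_volume Q + signed_volume R)) *\<^sub>R
    (signed_volume Q *\<^sub>R ccm Q + signed_volume R *\<^sub>R ccm R)"
proof -
  \<comment> \<open>Additivity of \<open>lift_det\<close> sums is used twice: the identity lift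
    gives the volumes, the paraboloid lifts give the coordinates of volume times
    \<open>ccm\<close>.\<close>
  have vol: "signed_volume P = signed_volume Q + signed_volume R"
    using assms(1-3) sum_lift_det_additive[OF assms(4), of "\<lambda>v. v" 0]
    by (simp add: signed_volume_eq[where b = 0] simplicial_polyhedron_def add_divide_distrib)
  have "signed_volume P *\<^sub>R ccm P = signed_volume Q *\<^sub>R ccm Q + signed_volume R *\<^sub>R ccm R"
    unfolding volume_scaled_ccm[OF assms(1,5), where b = 0]
      volume_scaled_ccm[OF assms(2,6), where b = 0] volume_scaled_ccm[OF assms(3,7), where b = 0]
    by (simp add: vec_eq_iff sum_lift_det_additive[OF assms(4)] add_divide_distrib)
  moreover have "ccm P = (1 / signed_volume P) *\<^sub>R (signed_volume P *\<^sub>R ccm P)"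
    using assms(5) by simp
  ultimately show ?thesis
    by (simp only: vol)
qed

end
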